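(* Marginal-Cost-Greedy-Dodgson (defined in the context) is a $(\ln m+1)$-approximation of the Dodgson score, where $m$ is the number of candidates in the input election. That is, for every preference profile $P$ over $m$ candidates and every candidate $c$, the number $A(P,c)$ output by Marginal-Cost-Greedy-Dodgson on input $(P,c)$ satisfies $$\mathrm{Dodgson}(P,c)\ \le\ A(P,c)\ \le\ (\ln m+1)\cdot \mathrm{Dodgson}(P,c),$$ where $\mathrm{Dodgson}(P,c)$ is the Dodgson score of $c$ in $P$.
   Context: Elections. $C=\{1,\ldots,m\}$ is the set of candidates, $\mathcal{L}(C)$ the set of all rankings (strict total orders) of $C$, and a preference profile with $n$ voters is a tuple $P=\langle >_1,\ldots,>_n\rangle\in\mathcal{L}(C)^n$ ($d>_i c$ means voter $i$ prefers $d$ to $c$). Write $c(>_i)=|\{d\in C: c>_i d\}|$. For distinct $c,d\in C$ the vote deficit of $c$ against $d$ is $\mathrm{Deficit}(P,c,d)=\max\{0,\ |\{i: d>_i c\}|-|\{i: c>_i d\}|\}$, and $\mathrm{Deficit}(P,c)=\sum_{d\in C\setminus\{c\}}\mathrm{Deficit}(P,c,d)$. Swaps. An edit is a map from preference profiles to preference profiles; $P\circ e$ denotes the result of applying $e$ to $P$. A swap is an edit designated by a pair $(i,j)\in\mathbb{N}^2$: if $1\le i\le n$ and $0<j<m$, it exchanges in voter $i$'s ranking the two adjacent candidates $a,b$ with $b(>_i)=j$ and $a(>_i)=j-1$ (so that afterwards $a$ is immediately above $b$), leaving everything else unchanged; otherwise it leaves the profile unchanged. Candidates $a,b$ are said to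 be involved in the swap. A sequence of swaps $s_1,\ldots,s_p$ is $c$-normal on $P$ if for each $k$, writing $s_k=(i,j)$, candidate $c$ is involved in $s_k$ applied to $P\circ s_1\circ\cdots\circ s_{k-1}$ and $c(>_i)=j-1$ in that profile (i.e. each swap moves $c$ up one position in some voter's ranking). Dodgson score. The Dodgson score of $c$ in $P$ is the smallest $p\in\mathbb{N}$ for which there is a sequence of swaps $\langle e_1,\ldots,e_p\rangle$ with $\mathrm{Deficit}(P\circ e_1\circ\cdots\circ e_p,c)=0$. Deficit reductions. For a sequence of edits $S'=\langle e_1,\ldots,e_p\rangle$, let $D(P,c,S')$ be the sequence of all deficit reductions caused by applying $S'$ to $P$, i.e. there is one entry for each pair $(k,d)$ with $1\le k\le p$, $d\in C\setminus\{c\}$ and $\mathrm{Deficit}(P\circ e_1\circ\cdots\circ e_{k-1},c,d)>\mathrm{Deficit}(P\circ e_1\circ\cdots\circ e_k,c,d)$. $|D(P,c,S')|$ is its length. The marginal cost of $S'$ on $P$ is $|S'|/|D(P,c,S')|$, defined to be $\infty$ if $|D(P,c,S')|=0$. Algorithm Marginal-Cost-Greedy-Dodgson. Input: a preference profile $P$ and a candidate $c$. Start with $S=\langle\rangle$. While $\mathrm{Deficit}(P,c)>0$: choose $S'=\langle e_1,\ldots,e_p\rangle$ minimizing the marginal cost $|S'|/|D(P,c,S')|$ over all $S'\in\mathcal{E}'$, where $\mathcal{E}'$ is the collection of all swap sequences that are $c$-normal on the current profile $P$ and all of whose swaps apply to one single voter's ranking (ties broken arbitrarily); replace $P$ by $P\circ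 e_1\circ\cdots\circ e_p$ and append $\langle e_1,\ldots,e_p\rangle$ to $S$. When the loop ends, output $|S|$. *)

theory Defs
  imports Complex_Main "HOL-Library.Extended_Real"
begin

text \<open>A ranking is the strict total order itself: \<open>(d, c) \<in> r\<close> means that \<open>d\<close> is preferred
  to \<open>c\<close>. A profile is the list of the voters' rankings. Voters are numbered from 1, so voter
  \<open>i\<close> is the list element with index \<open>i - 1\<close>.\<close>

type_synonym ranking = "(nat \<times> nat) set"
type_synonym profile = "ranking list"
type_synonym swap = "nat \<times> nat"

definition candidates :: "nat \<Rightarrow> nat set" where
  "candidates m = {1..m}"

definition rankings :: "nat \<Rightarrow> ranking set" where
  "rankings m = {r. r \<subseteq> candidates m \<times> candidates m \<and>
                    strict_linear_order_on (candidates m) r}"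

definition profiles :: "nat \<Rightarrow> nat \<Rightarrow> profile set" where
  "profiles m n = {P. length P = n \<and> set P \<subseteq> rankings m}"

definition voter :: "profile \<Rightarrow> nat \<Rightarrow> ranking" where
  "voter P i = P ! (i - 1)"

definition height :: "nat \<Rightarrow> ranking \<Rightarrow> nat \<Rightarrow> nat" where
  "height m r c = card {d \<in> candidates m. (c, d) \<in> r}"

definition deficit_against :: "profile \<Rightarrow> nat \<Rightarrow> nat \<Rightarrow> int" where
  "deficit_against P c d =
     max 0 (int (card {i \<in> {1..length P}. (d, c) \<in> voter P i}) -
            int (card {i \<in> {1..length P}. (c, d) \<in> voter P i}))"

definition deficit :: "nat \<Rightarrow> profile \<Rightarrow> nat \<Rightarrow> int" where
  "deficit m P c = (\<Sum>d \<in> candidates m - {c}. deficit_against P c d)"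

text \<open>The description in \<open>candidate_at\<close> is proper whenever \<open>r \<in> rankings m\<close> and \<open>j < m\<close>;
  it is used only in that case.\<close>

definition candidate_at :: "nat \<Rightarrow> ranking \<Rightarrow> nat \<Rightarrow> nat" where
  "candidate_at m r j = (THE x. x \<in> candidates m \<and> height m r x = j)"

definition effective_swap :: "nat \<Rightarrow> profile \<Rightarrow> swap \<Rightarrow> bool" where
  "effective_swap m P s = (case s of (i, j) \<Rightarrow> 1 \<le> i \<and> i \<le> length P \<and> 0 < j \<and> j < m)"

definition involved :: "nat \<Rightarrow> profile \<Rightarrow> swap \<Rightarrow> nat set" where
  "involved m P s = (case s of (i, j) \<Rightarrow>
     if effective_swap m P (i, j)
     then {candidate_at m (voter P i) (j - 1), candidate_at m (voter P i) j} else {})"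

text \<open>Exchanging the adjacent candidates \<open>a\<close> and \<open>b\<close> reverses the pair \<open>(b, a)\<close> and changes no
  other comparison.\<close>

definition exchange_at :: "nat \<Rightarrow> nat \<Rightarrow> ranking \<Rightarrow> ranking" where
  "exchange_at m j r =
     (let b = candidate_at m r j; a = candidate_at m r (j - 1) in insert (a, b) (r - {(b, a)}))"

definition apply_swap :: "nat \<Rightarrow> swap \<Rightarrow> profile \<Rightarrow> profile" where
  "apply_swap m s P = (case s of (i, j) \<Rightarrow>
     if effective_swap m P (i, j) then P[i - 1 := exchange_at m j (voter P i)] else P)"

definition apply_swaps :: "nat \<Rightarrow> swap list \<Rightarrow> profile \<Rightarrow> profile" where
  "apply_swaps m es P = fold (apply_swap m) es P"

definition c_normal :: "nat \<Rightarrow> nat \<Rightarrow> profile \<Rightarrow> swap list \<Rightarrow> bool" where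
  "c_normal m c P es \<longleftrightarrow>
     (\<forall>k \<in> {1..length es}. case es ! (k - 1) of (i, j) \<Rightarrow>
        let Q = apply_swaps m (take (k - 1) es) P
        in c \<in> involved m Q (i, j) \<and> height m (voter Q i) c = j - 1)"

definition dodgson_score :: "nat \<Rightarrow> profile \<Rightarrow> nat \<Rightarrow> nat" where
  "dodgson_score m P c =
     (LEAST p. \<exists>es :: swap list. length es = p \<and> deficit m (apply_swaps m es P) c = 0)"

text \<open>The deficit reductions are recorded by the set of their positions \<open>(k, d)\<close>; only their
  number matters.\<close>

definition deficit_reductions :: "nat \<Rightarrow> profile \<Rightarrow> nat \<Rightarrow> swap list \<Rightarrow> (nat \<times> nat) set" where
  "deficit_reductions m P c es =
     {(k, d). k \<in> {1..length es} \<and> d \<in> candidates m - {c} \<and>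
        deficit_against (apply_swaps m (take (k - 1) es) P) c d >
        deficit_against (apply_swaps m (take k es) P) c d}"

definition marginal_cost :: "nat \<Rightarrow> profile \<Rightarrow> nat \<Rightarrow> swap list \<Rightarrow> ereal" where
  "marginal_cost m P c es =
     (if card (deficit_reductions m P c es) = 0 then \<infinity>
      else ereal (real (length es) / real (card (deficit_reductions m P c es))))"

definition single_voter_normal :: "nat \<Rightarrow> nat \<Rightarrow> profile \<Rightarrow> swap list set" where
  "single_voter_normal m c P =
     {es. c_normal m c P es \<and> (\<exists>i. \<forall>s \<in> set es. fst s = i)}"

text \<open>One iteration of the loop on \<open>P\<close> may choose \<open>es\<close>. As ties are broken arbitrarily, this and
  the runs of the algorithm are relations.\<close>

definition greedy_choice :: "nat \<Rightarrow> nat \<Rightarrow> profile \<Rightarrow> swap list \<Rightarrow> bool" where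
  "greedy_choice m c P es \<longleftrightarrow>
     deficit m P c > 0 \<and>
     is_arg_min (marginal_cost m P c) (\<lambda>es. es \<in> single_voter_normal m c P) es"

text \<open>\<open>greedy_run m c P S\<close>: some run started on \<open>P\<close> halts having accumulated the sequence \<open>S\<close>.\<close>

inductive greedy_run :: "nat \<Rightarrow> nat \<Rightarrow> profile \<Rightarrow> swap list \<Rightarrow> bool" for m c where
  halt: "\<not> deficit m P c > 0 \<Longrightarrow> greedy_run m c P []"
| iterate: "greedy_choice m c P es \<Longrightarrow> greedy_run m c (apply_swaps m es P) S
    \<Longrightarrow> greedy_run m c P (es @ S)"

definition greedy_output :: "nat \<Rightarrow> nat \<Rightarrow> profile \<Rightarrow> nat \<Rightarrow> bool" where
  "greedy_output m c P A \<longleftrightarrow> (\<exists>S. greedy_run m c P S \<and> A = length S)"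

definition greedy_diverges :: "nat \<Rightarrow> nat \<Rightarrow> profile \<Rightarrow> bool" where
  "greedy_diverges m c P \<longleftrightarrow>
     (\<exists>Q es. Q 0 = P \<and>
        (\<forall>k :: nat. greedy_choice m c (Q k) (es k) \<and> Q (Suc k) = apply_swaps m (es k) (Q k)))"

end

theory Submission
  imports Defs "HOL-Analysis.Harmonic_Numbers"
begin

text \<open>The problem of raising \<open>c\<close> is an instance of set multicover, and the greedy rule is analysed as
  Chvatal does for set cover. An optimal swap sequence, not necessarily \<open>c\<close>-normal, provides a cover
  \<open>W\<close>: for each opponent \<open>d\<close> exactly as many voters \<open>i\<close> as \<open>c\<close> must win over against \<open>d\<close>, at a
  price of \<open>k i\<close> upward moves for voter \<open>i\<close>, where the \<open>k i\<close> sum up to at most the length of the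
  sequence. Each voter of the cover offers the marginal cost \<open>k i / card (W `` {i})\<close>, so a greedy
  step of \<open>L\<close> swaps and \<open>R\<close> reductions has \<open>L / R\<close> no greater. Each of its reductions lets one pair be
  dropped from the cover, so the potential \<open>\<Sum>i. k i * harm (card (W `` {i}))\<close> falls by at least
  \<open>L\<close>. The initial potential is at most \<open>harm m\<close> times the optimum.\<close>

section \<open>Rankings described by the heights of the candidates\<close>

lemma finite_candidates [simp]: "finite (candidates m)"
  and card_candidates [simp]: "card (candidates m) = m"
  by (simp_all add: candidates_def)

text \<open>A ranking built from prescribed heights. The ranking after an exchange is recognised as
  one of this form.\<close>

definition order_of :: "nat \<Rightarrow> (nat \<Rightarrow> nat) \<Rightarrow> ranking" where
  "order_of m f = {(x, y). x \<in> candidates m \<and> y \<in> candidates m \<and> f y < f x}"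

lemma order_of_rankings:
  assumes "inj_on f (candidates m)"
  shows "order_of m f \<in> rankings m"
  using inj_onD[OF assms]
  unfolding rankings_def order_of_def strict_linear_order_on_def trans_def irrefl_def total_on_def
  by (auto, meson linorder_neqE_nat)

lemma height_order_of:
  assumes f: "bij_betw f (candidates m) {..<m}" and x: "x \<in> candidates m"
  shows "height m (order_of m f) x = f x"
proof -
  have "card {d \<in> candidates m. f d < f x} = card (f ` {d \<in> candidates m. f d < f x})"
    using f by (intro card_image[symmetric]) (auto simp: bij_betw_def inj_on_def)
  also have "f ` {d \<in> candidates m. f d < f x} = {..<f x}"
  proof -
    have im: "f ` candidates m = {..<m}" using f by (simp add: bij_betw_def)
    then have "f x < m" using x by auto
    then have "{..<f x} \<subseteq> f ` candidates m" by (auto simp: im)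
    then show ?thesis by auto
  qed
  finally show ?thesis using x by (simp add: height_def order_of_def)
qed

text \<open>By transitivity and irreflexivity, the set below the worse candidate is a proper subset
  of the set below the better one; totality gives the converse. Comparisons thereby become
  arithmetic on heights.\<close>

lemma mem_ranking_iff:
  assumes r: "r \<in> rankings m" and x: "x \<in> candidates m" and y: "y \<in> candidates m"
  shows "(x, y) \<in> r \<longleftrightarrow> height m r y < height m r x"
proof -
  have tr: "trans r" and irr: "irrefl r" and tot: "total_on (candidates m) r"
    using r by (auto simp: rankings_def strict_linear_order_on_def)
  have mono: "height m r b < height m r a"
    if "(a, b) \<in> r" "a \<in> candidates m" "b \<in> candidates m" for a b
    unfolding height_def
  proof (intro psubset_card_mono psubsetI)
    show "{d \<in> candidates m. (b, d) \<in> r} \<subseteq> {d \<in> candidates m. (a, d) \<in> r}"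
      using that tr by (auto dest: transD)
    show "{d \<in> candidates m. (b, d) \<in> r} \<noteq> {d \<in> candidates m. (a, d) \<in> r}"
      using that irr by (auto simp: irrefl_def)
  qed auto
  show ?thesis
    using mono[of x y] mono[of y x] x y tot by (fastforce simp: total_on_def)
qed

text \<open>No candidate lies below itself, so the \<open>m\<close> distinct heights are all less
  than \<open>m\<close> and must exhaust \<open>{..<m}\<close>.\<close>

lemma bij_betw_height:
  assumes r: "r \<in> rankings m"
  shows "bij_betw (height m r) (candidates m) {..<m}"
proof -
  have inj: "inj_on (height m r) (candidates m)"
  proof (rule inj_onI)
    fix x y assume "x \<in> candidates m" "y \<in> candidates m" "height m r x = height m r y"
    moreover have "total_on (candidates m) r"
      using r by (auto simp: rankings_def strict_linear_order_on_def)
    ultimately show "x = y"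
      using mem_ranking_iff[OF r] by (metis less_irrefl total_on_def)
  qed
  have "height m r x < m" if "x \<in> candidates m" for x
  proof -
    have "{d \<in> candidates m. (x, d) \<in> r} \<subset> candidates m"
      using that mem_ranking_iff[OF r that that] by auto
    then have "card {d \<in> candidates m. (x, d) \<in> r} < card (candidates m)"
      by (intro psubset_card_mono) auto
    then show ?thesis by (simp add: height_def)
  qed
  then have "height m r ` candidates m \<subseteq> {..<m}" by auto
  moreover have "card (height m r ` candidates m) = m"
    using card_image[OF inj] by simp
  ultimately have "height m r ` candidates m = {..<m}"
    by (intro card_subset_eq) auto
  with inj show ?thesis by (simp add: bij_betw_def)
qed

lemma height_less: "r \<in> rankings m \<Longrightarrow> x \<in> candidates m \<Longrightarrow> height m r x < m"
  using bij_betw_height[of r m] by (auto simp: bij_betw_def)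

lemma height_eq_iff:
  "r \<in> rankings m \<Longrightarrow> x \<in> candidates m \<Longrightarrow> y \<in> candidates m \<Longrightarrow>
    height m r x = height m r y \<longleftrightarrow> x = y"
  using bij_betw_height[of r m] by (auto simp: bij_betw_def inj_on_def)

lemma candidate_at_height:
  assumes "r \<in> rankings m" and "x \<in> candidates m"
  shows "candidate_at m r (height m r x) = x"
  unfolding candidate_at_def using assms by (intro the_equality) (auto simp: height_eq_iff)

lemma candidate_at:
  assumes "r \<in> rankings m" and "j < m"
  shows "candidate_at m r j \<in> candidates m" and "height m r (candidate_at m r j) = j"
proof -
  have "j \<in> height m r ` candidates m"
    using bij_betw_height[OF assms(1)] assms(2) by (simp add: bij_betw_def)
  then obtain x where "x \<in> candidates m" "height m r x = j" by auto
  with candidate_at_height[OF assms(1), of x]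
  show "candidate_at m r j \<in> candidates m" "height m r (candidate_at m r j) = j" by auto
qed

text \<open>An exchange acts on heights as the transposition \<open>g\<close> of \<open>j\<close>
  and \<open>j - 1\<close>. Once the new ranking is identified with
  \<open>order_of m (g \<circ> height m r)\<close>, both claims follow from bijectivity.\<close>

lemma exchange_at:
  assumes r: "r \<in> rankings m" and j: "0 < j" "j < m"
  shows exchange_at_rankings: "exchange_at m j r \<in> rankings m"
    and height_exchange_at: "x \<in> candidates m \<Longrightarrow> height m (exchange_at m j r) x =
      (if height m r x = j then j - 1 else if height m r x = j - 1 then j else height m r x)"
proof -
  define g where "g h = (if h = j then j - 1 else if h = j - 1 then j else h)" for h
  let ?a = "candidate_at m r (j - 1)" and ?b = "candidate_at m r j"
  have a: "x = ?a \<longleftrightarrow> height m r x = j - 1" and b: "x = ?b \<longleftrightarrow> height m r x = j"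
    if "x \<in> candidates m" for x
    using candidate_at[OF r, of j] candidate_at[OF r, of "j - 1"] candidate_at_height[OF r that] j
    by auto
  have sub: "r \<subseteq> candidates m \<times> candidates m" using r by (simp add: rankings_def)
  have "(x, y) \<in> exchange_at m j r \<longleftrightarrow> (x, y) \<in> order_of m (g \<circ> height m r)" for x y
  proof (cases "x \<in> candidates m \<and> y \<in> candidates m")
    case True
    then have "(x, y) \<in> exchange_at m j r \<longleftrightarrow> (height m r x = j - 1 \<and> height m r y = j) \<or>
        (height m r y < height m r x \<and> \<not> (height m r x = j \<and> height m r y = j - 1))"
      using a b mem_ranking_iff[OF r] by (simp add: exchange_at_def Let_def)
    then show ?thesis using True j by (auto simp: order_of_def g_def)
  next
    case False
    moreover have "j - 1 < m" using j by simp
    ultimately show ?thesis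
      using sub candidate_at[OF r, of j] candidate_at[OF r, of "j - 1"] j
      by (auto simp: exchange_at_def Let_def order_of_def)
  qed
  then have eq: "exchange_at m j r = order_of m (g \<circ> height m r)" by auto
  \<comment> \<open>The transposition \<open>g\<close> is its own inverse.\<close>
  have "bij_betw g {..<m} {..<m}"
    by (rule bij_betwI[of _ _ _ g]) (use j in \<open>auto simp: g_def\<close>)
  then have bij: "bij_betw (g \<circ> height m r) (candidates m) {..<m}"
    using bij_betw_height[OF r] bij_betw_trans by blast
  show "exchange_at m j r \<in> rankings m"
    unfolding eq using bij by (intro order_of_rankings) (simp add: bij_betw_def)
  show "height m (exchange_at m j r) x =
      (if height m r x = j then j - 1 else if height m r x = j - 1 then j else height m r x)"
    if "x \<in> candidates m"
    unfolding eq height_order_of[OF bij that] by (simp add: g_def)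
qed

section \<open>Profiles under swaps\<close>

lemma voter_rankings: "P \<in> profiles m n \<Longrightarrow> i \<in> {1..n} \<Longrightarrow> voter P i \<in> rankings m"
  by (auto simp: profiles_def voter_def intro!: subsetD[OF _ nth_mem])

lemma length_profiles: "P \<in> profiles m n \<Longrightarrow> length P = n"
  by (simp add: profiles_def)

lemma apply_swaps_snoc: "apply_swaps m (es @ [s]) P = apply_swap m s (apply_swaps m es P)"
  by (simp add: apply_swaps_def)

lemma apply_swaps_append:
  "apply_swaps m (es @ fs) P = apply_swaps m fs (apply_swaps m es P)"
  by (simp add: apply_swaps_def)

lemma apply_swaps_Nil [simp]: "apply_swaps m [] P = P"
  by (simp add: apply_swaps_def)

lemma effective_swap_iff:
  "P \<in> profiles m n \<Longrightarrow> effective_swap m P (i, j) \<longleftrightarrow> i \<in> {1..n} \<and> 0 < j \<and> j < m"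
  by (auto simp: effective_swap_def profiles_def)

lemma voter_apply_swap:
  assumes "P \<in> profiles m n" and "k \<in> {1..n}"
  shows "voter (apply_swap m (i, j) P) k =
    (if k = i \<and> 0 < j \<and> j < m then exchange_at m j (voter P k) else voter P k)"
  using assms effective_swap_iff[OF assms(1), of i j]
  by (auto simp: apply_swap_def voter_def nth_list_update profiles_def)

lemma apply_swap_profiles:
  assumes P: "P \<in> profiles m n"
  shows "apply_swap m s P \<in> profiles m n"
proof (cases s)
  case (Pair i j)
  show ?thesis
  proof (cases "effective_swap m P (i, j)")
    case True
    then have "i \<in> {1..n}" "0 < j" "j < m" using effective_swap_iff[OF P] by auto
    then have "exchange_at m j (voter P i) \<in> rankings m"
      using exchange_at_rankings voter_rankings[OF P] by blast
    then show ?thesis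
      using P True set_update_subset_insert[of P "i - 1" "exchange_at m j (voter P i)"]
      by (auto simp: Pair apply_swap_def profiles_def)
  qed (use P in \<open>simp add: Pair apply_swap_def\<close>)
qed

lemma apply_swaps_profiles:
  "P \<in> profiles m n \<Longrightarrow> apply_swaps m es P \<in> profiles m n"
  by (induction es rule: rev_induct) (simp_all add: apply_swaps_snoc apply_swap_profiles)

section \<open>Lifting \<open>c\<close> in the ranking of one voter\<close>

text \<open>With \<open>h\<close> the height of \<open>c\<close> for voter \<open>v\<close>, the
  swap \<open>(v, h + j)\<close> exchanges \<open>c\<close>, by then at height
  \<open>h + j - 1\<close>, with the candidate just above it.\<close>

definition lift_swaps :: "nat \<Rightarrow> nat \<Rightarrow> nat \<Rightarrow> swap list" where
  "lift_swaps v h L = map (\<lambda>j. (v, h + j)) [1..<Suc L]"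

lemma lift_swaps_0 [simp]: "lift_swaps v h 0 = []"
  by (simp add: lift_swaps_def)

lemma lift_swaps_Suc: "lift_swaps v h (Suc L) = lift_swaps v h L @ [(v, h + Suc L)]"
  by (simp add: lift_swaps_def)

lemma length_lift_swaps [simp]: "length (lift_swaps v h L) = L"
  by (simp add: lift_swaps_def)

lemma take_lift_swaps: "k \<le> L \<Longrightarrow> take k (lift_swaps v h L) = lift_swaps v h k"
  by (simp add: lift_swaps_def take_map take_upt del: upt_Suc)

lemma voter_apply_lift_swaps_other:
  assumes P: "P \<in> profiles m n" and i: "i \<in> {1..n}" "i \<noteq> v"
  shows "voter (apply_swaps m (lift_swaps v h L) P) i = voter P i"
proof (induction L)
  case (Suc L)
  then show ?case
    using i voter_apply_swap[OF apply_swaps_profiles[OF P] i(1)]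
    by (simp add: lift_swaps_Suc apply_swaps_snoc)
qed simp

text \<open>Each swap moves \<open>c\<close> past one more candidate, which drops by one position
  and is not touched again.\<close>

lemma height_apply_lift_swaps:
  assumes P: "P \<in> profiles m n" and c: "c \<in> candidates m" and v: "v \<in> {1..n}"
    and x: "x \<in> candidates m" and L: "height m (voter P v) c + L < m"
  shows "height m (voter (apply_swaps m (lift_swaps v (height m (voter P v) c) L) P) v) x =
    (if x = c then height m (voter P v) c + L
     else if height m (voter P v) c < height m (voter P v) x \<and>
             height m (voter P v) x \<le> height m (voter P v) c + L
     then height m (voter P v) x - 1 else height m (voter P v) x)"
  using L
proof (induction L)
  case 0
  then show ?case by auto
next
  case (Suc L)
  let ?h = "height m (voter P v)"
  let ?Q = "apply_swaps m (lift_swaps v (?h c) L) P"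
  have ne: "x \<noteq> c \<Longrightarrow> ?h x \<noteq> ?h c"
    using height_eq_iff[OF voter_rankings[OF P v]] x c by auto
  have Q: "?Q \<in> profiles m n" using P by (rule apply_swaps_profiles)
  have "voter (apply_swaps m (lift_swaps v (?h c) (Suc L)) P) v =
      exchange_at m (?h c + Suc L) (voter ?Q v)"
    using Suc.prems voter_apply_swap[OF Q v] by (simp add: lift_swaps_Suc apply_swaps_snoc)
  moreover have IH: "height m (voter ?Q v) x =
    (if x = c then ?h c + L else if ?h c < ?h x \<and> ?h x \<le> ?h c + L then ?h x - 1 else ?h x)"
    using Suc by simp
  moreover define y where "y = height m (voter ?Q v) x"
  ultimately have "height m (voter (apply_swaps m (lift_swaps v (?h c) (Suc L)) P) v) x =
      (if y = ?h c + Suc L then ?h c + L else if y = ?h c + L then ?h c + Suc L else y)"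
    using height_exchange_at[OF voter_rankings[OF Q v] _ Suc.prems x] by simp
  then show ?case using ne IH[folded y_def] by (auto split: if_splits)
qed

text \<open>Turns the quantification over positions into a recursion that suits
  \<open>rev_induct\<close>.\<close>

lemma c_normal_snoc:
  "c_normal m c P (es @ [(i, j)]) \<longleftrightarrow> c_normal m c P es \<and>
    c \<in> involved m (apply_swaps m es P) (i, j) \<and>
    height m (voter (apply_swaps m es P) i) c = j - 1"
proof -
  have "{1..length (es @ [(i, j)])} = insert (Suc (length es)) {1..length es}" by auto
  moreover have "(es @ [(i, j)]) ! (k - 1) = es ! (k - 1)"
    "take (k - 1) (es @ [(i, j)]) = take (k - 1) es" if "k \<in> {1..length es}" for k
    using that by (auto simp: nth_append)
  ultimately show ?thesis by (auto simp: c_normal_def Let_def)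
qed

text \<open>Normality forces every swap to start at the current height of \<open>c\<close>, so the
  voter and the length determine the whole sequence.\<close>

lemma single_voter_normalD:
  assumes P: "P \<in> profiles m n" and c: "c \<in> candidates m"
    and normal: "c_normal m c P es" and v: "\<forall>s \<in> set es. fst s = v" and "es \<noteq> []"
  shows "v \<in> {1..n} \<and> height m (voter P v) c + length es < m \<and>
    es = lift_swaps v (height m (voter P v) c) (length es)"
  using normal v \<open>es \<noteq> []\<close>
proof (induction es rule: rev_induct)
  case (snoc s es)
  let ?h = "height m (voter P v)" and ?Q = "apply_swaps m es P"
  obtain j where s: "s = (v, j)" using snoc.prems(2) by (cases s) auto
  have normal: "c_normal m c P es" and inv: "c \<in> involved m ?Q (v, j)"
    and hQ: "height m (voter ?Q v) c = j - 1"
    using snoc.prems(1) by (simp_all add: s c_normal_snoc)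
  have eff: "v \<in> {1..n}" "0 < j" "j < m"
    using inv effective_swap_iff[OF apply_swaps_profiles[OF P], of es v j]
    by (auto simp: involved_def split: if_splits)
  have es: "?h c + length es < m \<and> es = lift_swaps v (?h c) (length es)"
  \<comment> \<open>The induction hypothesis speaks of nonempty sequences only; for the empty prefix
    the bound is that on the height of \<open>c\<close>.\<close>
  proof (cases "es = []")
    case True
    then show ?thesis using height_less[OF voter_rankings[OF P eff(1)] c] by simp
  next
    case False
    then show ?thesis using snoc normal by auto
  qed
  then have "height m (voter ?Q v) c = ?h c + length es"
    using height_apply_lift_swaps[OF P c eff(1) c, of "length es"] by auto
  with hQ eff have "j = ?h c + Suc (length es)" by auto
  with es eff show ?case by (auto simp: s lift_swaps_Suc)
qed simp

lemma lift_swaps_single_voter_normal: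
  assumes P: "P \<in> profiles m n" and c: "c \<in> candidates m" and v: "v \<in> {1..n}"
    and L: "height m (voter P v) c + L < m"
  shows "lift_swaps v (height m (voter P v) c) L \<in> single_voter_normal m c P"
proof -
  let ?h = "height m (voter P v)"
  have "c_normal m c P (lift_swaps v (?h c) L)"
    using L
  proof (induction L)
    case 0
    then show ?case by (simp add: c_normal_def)
  next
    case (Suc L)
    let ?Q = "apply_swaps m (lift_swaps v (?h c) L) P"
    have Q: "?Q \<in> profiles m n" using P by (rule apply_swaps_profiles)
    have hQ: "height m (voter ?Q v) c = ?h c + L"
      using height_apply_lift_swaps[OF P c v c, of L] Suc.prems by simp
    have "candidate_at m (voter ?Q v) (?h c + L) = c"
      using candidate_at_height[OF voter_rankings[OF Q v] c] hQ by simp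
    then show ?case
      using Suc hQ v effective_swap_iff[OF Q, of v "?h c + Suc L"]
      by (auto simp: lift_swaps_Suc c_normal_snoc involved_def)
  qed
  then show ?thesis by (auto simp: single_voter_normal_def lift_swaps_def)
qed

text \<open>Ensures that the marginal cost attains a minimum. The empty sequence is added
  separately, since it determines no voter.\<close>

lemma finite_single_voter_normal:
  assumes P: "P \<in> profiles m n" and c: "c \<in> candidates m"
  shows "finite (single_voter_normal m c P)"
proof -
  have "single_voter_normal m c P \<subseteq>
      insert [] ((\<lambda>(v, L). lift_swaps v (height m (voter P v) c) L) ` ({1..n} \<times> {..<m}))"
  proof
    fix es assume "es \<in> single_voter_normal m c P"
    then obtain v where v: "c_normal m c P es" "\<forall>s \<in> set es. fst s = v"
      by (auto simp: single_voter_normal_def)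
    show "es \<in> insert [] ((\<lambda>(v, L). lift_swaps v (height m (voter P v) c) L) ` ({1..n} \<times> {..<m}))"
    proof (cases "es = []")
      case False
      from single_voter_normalD[OF P c v this]
      show ?thesis by (intro insertI2 image_eqI[of _ _ "(v, length es)"]) auto
    qed simp
  qed
  then show ?thesis by (rule finite_subset) simp
qed

section \<open>Votes, demands and deficit reductions under a lift\<close>

definition overtaken :: "nat \<Rightarrow> ranking \<Rightarrow> nat \<Rightarrow> nat \<Rightarrow> nat set" where
  "overtaken m r c L =
     {x \<in> candidates m. height m r c < height m r x \<and> height m r x \<le> height m r c + L}"

lemma mem_apply_lift_swaps_iff:
  assumes P: "P \<in> profiles m n" and c: "c \<in> candidates m" and v: "v \<in> {1..n}"
    and L: "height m (voter P v) c + L < m"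
    and d: "d \<in> candidates m - {c}" and i: "i \<in> {1..n}"
  shows "(d, c) \<in> voter (apply_swaps m (lift_swaps v (height m (voter P v) c) L) P) i \<longleftrightarrow>
    (d, c) \<in> voter P i \<and> \<not> (i = v \<and> d \<in> overtaken m (voter P v) c L)"
proof (cases "i = v")
  case True
  let ?Q = "apply_swaps m (lift_swaps v (height m (voter P v) c) L) P"
  have Q: "?Q \<in> profiles m n" using P by (rule apply_swaps_profiles)
  show ?thesis
    using mem_ranking_iff[OF voter_rankings[OF Q v], of d c]
      mem_ranking_iff[OF voter_rankings[OF P v], of d c] c d
      height_apply_lift_swaps[OF P c v c L] height_apply_lift_swaps[OF P c v _ L, of d]
    by (auto simp: True overtaken_def)
next
  case False
  then show ?thesis using voter_apply_lift_swaps_other[OF P i] by simp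
qed

definition votes_against :: "profile \<Rightarrow> nat \<Rightarrow> nat \<Rightarrow> nat" where
  "votes_against P c d = card {i \<in> {1..length P}. (d, c) \<in> voter P i}"

text \<open>The number of voters that still have to be won over in the comparison with \<open>d\<close>, that is,
  half the deficit rounded up; the truncated subtraction yields 0 when there is no deficit.\<close>

definition demand :: "profile \<Rightarrow> nat \<Rightarrow> nat \<Rightarrow> nat" where
  "demand P c d = (2 * votes_against P c d + 1 - length P) div 2"

text \<open>Every voter decides between \<open>c\<close> and \<open>d\<close>, so the votes for
  \<open>c\<close> are the complement of those against it.\<close>

lemma deficit_against_eq:
  assumes P: "P \<in> profiles m n" and c: "c \<in> candidates m" and d: "d \<in> candidates m - {c}"
  shows "deficit_against P c d = max 0 (2 * int (votes_against P c d) - int n)"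
proof -
  let ?A = "{i \<in> {1..n}. (d, c) \<in> voter P i}"
  have "(c, d) \<in> voter P i \<longleftrightarrow> (d, c) \<notin> voter P i" if "i \<in> {1..n}" for i
    using mem_ranking_iff[OF voter_rankings[OF P that]] c d
      height_eq_iff[OF voter_rankings[OF P that], of c d] by auto
  then have "{i \<in> {1..n}. (c, d) \<in> voter P i} = {1..n} - ?A" by auto
  moreover have "?A \<subseteq> {1..n}" by auto
  then have "card ({1..n} - ?A) = n - card ?A" "card ?A \<le> n"
    using card_Diff_subset[of ?A "{1..n}"] card_mono[of "{1..n}" ?A] by simp_all
  ultimately show ?thesis
    by (simp add: deficit_against_def votes_against_def length_profiles[OF P])
qed

lemma deficit_against_pos_iff:
  assumes "P \<in> profiles m n" and "c \<in> candidates m" and "d \<in> candidates m - {c}"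
  shows "0 < deficit_against P c d \<longleftrightarrow> 0 < demand P c d"
  unfolding deficit_against_eq[OF assms] demand_def length_profiles[OF assms(1)] by linarith

lemma deficit_pos_iff:
  assumes "P \<in> profiles m n" and "c \<in> candidates m"
  shows "0 < deficit m P c \<longleftrightarrow> (\<exists>d \<in> candidates m - {c}. 0 < demand P c d)"
proof -
  have "deficit m P c = 0 \<longleftrightarrow> (\<forall>d \<in> candidates m - {c}. deficit_against P c d = 0)"
    unfolding deficit_def by (intro sum_nonneg_eq_0_iff) (auto simp: deficit_against_def)
  moreover have "0 \<le> deficit m P c"
    unfolding deficit_def by (intro sum_nonneg) (auto simp: deficit_against_def)
  moreover have "0 \<le> deficit_against P c d" for d by (simp add: deficit_against_def)
  ultimately show ?thesis
    using deficit_against_pos_iff[OF assms] by (metis less_le)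
qed

definition reduced :: "nat \<Rightarrow> profile \<Rightarrow> nat \<Rightarrow> nat \<Rightarrow> nat \<Rightarrow> nat set" where
  "reduced m P c v L = {d \<in> overtaken m (voter P v) c L. 0 < demand P c d}"

lemma finite_reduced [simp]: "finite (reduced m P c v L)"
  by (rule finite_subset[of _ "candidates m"]) (auto simp: reduced_def overtaken_def)

lemma reduced_subset: "reduced m P c v L \<subseteq> candidates m - {c}"
  by (auto simp: reduced_def overtaken_def)

lemma votes_against_apply_lift_swaps:
  assumes P: "P \<in> profiles m n" and c: "c \<in> candidates m" and v: "v \<in> {1..n}"
    and L: "height m (voter P v) c + L < m" and d: "d \<in> candidates m - {c}"
  shows "votes_against P c d =
    votes_against (apply_swaps m (lift_swaps v (height m (voter P v) c) L) P) c d +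
    (if d \<in> overtaken m (voter P v) c L then 1 else 0)"
proof -
  let ?Q = "apply_swaps m (lift_swaps v (height m (voter P v) c) L) P"
  let ?A = "{i \<in> {1..n}. (d, c) \<in> voter P i}" and ?B = "{i \<in> {1..n}. (d, c) \<in> voter ?Q i}"
  have B: "?B = ?A - (if d \<in> overtaken m (voter P v) c L then {v} else {})"
    using mem_apply_lift_swaps_iff[OF P c v L d] by auto
  have "v \<in> ?A" if "d \<in> overtaken m (voter P v) c L"
    using that v mem_ranking_iff[OF voter_rankings[OF P v], of d c] c d
    by (simp add: overtaken_def)
  then have "card ?A = card ?B + (if d \<in> overtaken m (voter P v) c L then 1 else 0)"
    unfolding B using card_Suc_Diff1[of ?A v] by simp
  then show ?thesis
    by (simp add: votes_against_def length_profiles[OF P] length_profiles[OF apply_swaps_profiles[OF P]])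
qed

text \<open>One vote fewer against \<open>c\<close> lowers the numerator of the demand by two, hence
  the demand by one, unless it is 0 already and stays so by truncation.\<close>

lemma demand_apply_lift_swaps:
  assumes P: "P \<in> profiles m n" and c: "c \<in> candidates m" and v: "v \<in> {1..n}"
    and L: "height m (voter P v) c + L < m" and d: "d \<in> candidates m - {c}"
  shows "demand P c d =
    demand (apply_swaps m (lift_swaps v (height m (voter P v) c) L) P) c d +
    (if d \<in> reduced m P c v L then 1 else 0)"
  using votes_against_apply_lift_swaps[OF assms]
  by (auto simp: reduced_def demand_def length_profiles[OF P]
      length_profiles[OF apply_swaps_profiles[OF P]])

text \<open>Each overtaken \<open>d\<close> is passed exactly once, at step
  \<open>height m (voter P v) d - height m (voter P v) c\<close>. Up to then its deficit is the
  initial one, so that step is a reduction exactly if the initial deficit is positive.\<close>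

lemma card_deficit_reductions_lift_swaps:
  assumes P: "P \<in> profiles m n" and c: "c \<in> candidates m" and v: "v \<in> {1..n}"
    and L: "height m (voter P v) c + L < m"
  shows "card (deficit_reductions m P c (lift_swaps v (height m (voter P v) c) L)) =
    card (reduced m P c v L)"
proof -
  let ?h = "height m (voter P v)"
  let ?Q = "\<lambda>k. apply_swaps m (lift_swaps v (?h c) k) P"
  have step: "deficit_against (?Q k) c d < deficit_against (?Q (k - 1)) c d \<longleftrightarrow>
      ?h d = ?h c + k \<and> 0 < demand P c d"
    if k: "k \<in> {1..L}" and d: "d \<in> candidates m - {c}" for k d
  proof -
    have k': "?h c + k < m" "?h c + (k - 1) < m" using k L by auto
    have "d \<in> overtaken m (voter P v) c k \<longleftrightarrow>
        d \<in> overtaken m (voter P v) c (k - 1) \<or> ?h d = ?h c + k"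
      "d \<in> overtaken m (voter P v) c (k - 1) \<Longrightarrow> ?h d \<noteq> ?h c + k"
      using k d by (auto simp: overtaken_def)
    then show ?thesis
      using votes_against_apply_lift_swaps[OF P c v k'(1) d]
        votes_against_apply_lift_swaps[OF P c v k'(2) d]
        deficit_against_pos_iff[OF P c d]
      unfolding deficit_against_eq[OF apply_swaps_profiles[OF P] c d] deficit_against_eq[OF P c d]
      by (auto split: if_splits)
  qed
  have "deficit_reductions m P c (lift_swaps v (?h c) L) =
      {(k, d). k \<in> {1..L} \<and> d \<in> candidates m - {c} \<and> ?h d = ?h c + k \<and> 0 < demand P c d}"
  proof -
    have "take (k - 1) (lift_swaps v (?h c) L) = lift_swaps v (?h c) (k - 1)"
      "take k (lift_swaps v (?h c) L) = lift_swaps v (?h c) k" if "k \<in> {1..L}" for k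
      using that by (auto intro!: take_lift_swaps)
    then show ?thesis unfolding deficit_reductions_def using step by auto
  qed
  also have "\<dots> = (\<lambda>d. (?h d - ?h c, d)) ` reduced m P c v L"
    by (auto simp: reduced_def overtaken_def image_iff)
  finally show ?thesis by (simp add: card_image inj_on_def)
qed

section \<open>The greedy rule in terms of lifts\<close>

text \<open>Minimality is stated by cross multiplication, so that it also holds for competing lifts
  without reductions, whose marginal cost is infinite. The chosen lift has reductions because some
  lift of finite cost exists.\<close>

lemma greedy_choiceE:
  assumes P: "P \<in> profiles m n" and c: "c \<in> candidates m" and choice: "greedy_choice m c P es"
  obtains v L where "v \<in> {1..n}" and "height m (voter P v) c + L < m"
    and "es = lift_swaps v (height m (voter P v) c) L" and "reduced m P c v L \<noteq> {}"
    and "\<And>i l. i \<in> {1..n} \<Longrightarrow> height m (voter P i) c + l < m \<Longrightarrow>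
      L * card (reduced m P c i l) \<le> l * card (reduced m P c v L)"
proof -
  define h where "h i = height m (voter P i) c" for i
  have es: "es \<in> single_voter_normal m c P"
    and min: "\<And>fs. fs \<in> single_voter_normal m c P \<Longrightarrow> marginal_cost m P c es \<le> marginal_cost m P c fs"
    using choice by (auto simp: greedy_choice_def is_arg_min_linorder)
  have le: "marginal_cost m P c es \<le> ereal (real l / real (card (reduced m P c i l)))"
    if "i \<in> {1..n}" "h i + l < m" "reduced m P c i l \<noteq> {}" for i l
    using min[OF lift_swaps_single_voter_normal[OF P c that(1) that(2)[unfolded h_def]]] that
      card_deficit_reductions_lift_swaps[OF P c that(1) that(2)[unfolded h_def]]
    by (simp add: marginal_cost_def)
  obtain d where d: "d \<in> candidates m - {c}" and pos: "0 < demand P c d"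
    using choice deficit_pos_iff[OF P c] by (auto simp: greedy_choice_def)
  from pos have "0 < votes_against P c d"
    by (cases "votes_against P c d") (auto simp: demand_def)
  then have "{i \<in> {1..n}. (d, c) \<in> voter P i} \<noteq> {}"
    by (auto simp: votes_against_def length_profiles[OF P] simp del: Collect_empty_eq)
  then obtain i where i: "i \<in> {1..n}" and di: "(d, c) \<in> voter P i" by auto
  have hi: "h i < m" and hd: "height m (voter P i) d < m"
    using height_less[OF voter_rankings[OF P i]] c d by (auto simp: h_def)
  \<comment> \<open>Raising \<open>c\<close> to the top of the ranking of \<open>i\<close> overtakes
    \<open>d\<close>; hence the minimal marginal cost is finite.\<close>
  have "d \<in> reduced m P c i (m - 1 - h i)"
    using di d pos hi hd c mem_ranking_iff[OF voter_rankings[OF P i], of d c]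
    by (auto simp: reduced_def overtaken_def h_def)
  then have fin: "card (deficit_reductions m P c es) \<noteq> 0"
    using le[OF i, of "m - 1 - h i"] hi by (fastforce simp: marginal_cost_def split: if_splits)
  then have "es \<noteq> []" by (auto simp: deficit_reductions_def)
  then obtain v where v: "v \<in> {1..n}" and L: "h v + length es < m"
    and es_eq: "es = lift_swaps v (h v) (length es)"
    using es single_voter_normalD[OF P c, of es] unfolding single_voter_normal_def h_def by blast
  define L where "L = length es"
  have card: "card (deficit_reductions m P c es) = card (reduced m P c v L)"
    using card_deficit_reductions_lift_swaps[OF P c v, of L] L es_eq by (simp add: L_def h_def)
  have "L * card (reduced m P c i l) \<le> l * card (reduced m P c v L)"
    if "i \<in> {1..n}" "h i + l < m" for i l
  proof (cases "reduced m P c i l = {}")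
    case False
    then have "real L / real (card (reduced m P c v L)) \<le> real l / real (card (reduced m P c i l))"
      using le[OF that False] fin card by (simp add: marginal_cost_def L_def)
    then have "real L * real (card (reduced m P c i l)) \<le> real l * real (card (reduced m P c v L))"
      using False fin card by (simp add: field_simps card_gt_0_iff)
    then show ?thesis by (simp only: of_nat_mult[symmetric] of_nat_le_iff)
  qed simp
  moreover have "reduced m P c v L \<noteq> {}" using fin card by auto
  ultimately show ?thesis using that v L es_eq unfolding L_def h_def by blast
qed

section \<open>Covers and their behaviour under a lift\<close>

text \<open>A pair \<open>(i, d)\<close> in a cover means that voter \<open>i\<close> is used to win the comparison with \<open>d\<close>, for
  which \<open>c\<close> need be raised by at most \<open>k i\<close> positions. Demands are met exactly, so that a pair can
  be dropped from the cover whenever the demand for its candidate decreases.\<close>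

definition cover ::
    "nat \<Rightarrow> nat \<Rightarrow> nat \<Rightarrow> (nat \<Rightarrow> nat) \<Rightarrow> profile \<Rightarrow> (nat \<times> nat) set \<Rightarrow> bool" where
  "cover m n c k P W \<longleftrightarrow>
     W \<subseteq> {1..n} \<times> (candidates m - {c}) \<and>
     (\<forall>d \<in> candidates m - {c}. card {i. (i, d) \<in> W} = demand P c d) \<and>
     (\<forall>(i, d) \<in> W. (d, c) \<in> voter P i \<and>
        height m (voter P i) d \<le> height m (voter P i) c + k i)"

lemma finite_cover: "cover m n c k P W \<Longrightarrow> finite W"
  unfolding cover_def by (rule finite_subset[of _ "{1..n} \<times> (candidates m - {c})"]) auto

lemma finite_cover_voters: "cover m n c k P W \<Longrightarrow> finite {i. (i, d) \<in> W}"
  by (rule finite_subset[of _ "fst ` W"]) (force simp: finite_cover)+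

lemma demand_pos_if_cover:
  assumes W: "cover m n c k P W" and i: "(i, d) \<in> W"
  shows "0 < demand P c d"
proof -
  have "d \<in> candidates m - {c}" using assms by (auto simp: cover_def)
  then have "demand P c d = card {i. (i, d) \<in> W}" using W by (simp add: cover_def)
  then show ?thesis using i finite_cover_voters[OF W, of d] by (auto simp: card_gt_0_iff)
qed

text \<open>For each reduced opponent the demand falls by one, and one pair is dropped. The
  remaining pairs keep their price \<open>k i\<close>, as \<open>c\<close> has not moved down with
  any voter.\<close>

lemma cover_apply_lift_swaps:
  assumes P: "P \<in> profiles m n" and c: "c \<in> candidates m" and v: "v \<in> {1..n}"
    and L: "height m (voter P v) c + L < m" and W: "cover m n c k P W"
  obtains W' where "W' \<subseteq> W" and "card W = card W' + card (reduced m P c v L)"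
    and "cover m n c k (apply_swaps m (lift_swaps v (height m (voter P v) c) L) P) W'"
proof -
  let ?h = "height m (voter P v)" and ?R = "reduced m P c v L"
  let ?Q = "apply_swaps m (lift_swaps v (?h c) L) P"
  \<comment> \<open>If \<open>(v, d)\<close> is in the cover, it must be the pair dropped for
    \<open>d\<close>, since \<open>v\<close> now prefers \<open>c\<close> to \<open>d\<close>;
    otherwise any pair for \<open>d\<close> will do.\<close>
  define f where "f d = (if (v, d) \<in> W then v else SOME i. (i, d) \<in> W)" for d
  define W' where "W' = W - (\<lambda>d. (f d, d)) ` ?R"
  have f: "(f d, d) \<in> W" if "d \<in> ?R" for d
  proof -
    have "d \<in> candidates m - {c}" using that reduced_subset by blast
    moreover have "0 < demand P c d" using that by (simp add: reduced_def)
    ultimately have "0 < card {i. (i, d) \<in> W}" using W by (simp add: cover_def)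
    then have "\<exists>i. (i, d) \<in> W" by (auto simp: card_gt_0_iff)
    then show ?thesis using someI_ex[of "\<lambda>i. (i, d) \<in> W"] by (simp add: f_def)
  qed
  have not_overtaken: "\<not> (i = v \<and> d \<in> overtaken m (voter P v) c L)" if "(i, d) \<in> W'" for i d
  proof
    assume *: "i = v \<and> d \<in> overtaken m (voter P v) c L"
    have "(i, d) \<in> W" using that by (simp add: W'_def)
    with * have "d \<in> ?R" "f d = i"
      using demand_pos_if_cover[OF W] by (auto simp: reduced_def f_def)
    with that show False by (auto simp: W'_def)
  qed
  have sub: "(\<lambda>d. (f d, d)) ` ?R \<subseteq> W" using f by auto
  have "card W = card W' + card ?R"
  proof -
    have "card ((\<lambda>d. (f d, d)) ` ?R) = card ?R" by (simp add: card_image inj_on_def)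
    then show ?thesis
      unfolding W'_def using card_Diff_subset[OF _ sub] card_mono[OF finite_cover[OF W] sub] by simp
  qed
  moreover have "W' \<subseteq> W" by (auto simp: W'_def)
  moreover have "cover m n c k ?Q W'"
    unfolding cover_def
  proof (intro conjI ballI)
    show "W' \<subseteq> {1..n} \<times> (candidates m - {c})" using W by (auto simp: W'_def cover_def)
  next
    fix d assume d: "d \<in> candidates m - {c}"
    have "{i. (i, d) \<in> W'} = {i. (i, d) \<in> W} - (if d \<in> ?R then {f d} else {})"
      by (auto simp: W'_def)
    moreover have "card {i. (i, d) \<in> W} = demand P c d" using W d by (simp add: cover_def)
    ultimately show "card {i. (i, d) \<in> W'} = demand ?Q c d"
      using f demand_apply_lift_swaps[OF P c v L d] by auto
  next
    fix x assume "x \<in> W'"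
    then obtain i d where x: "x = (i, d)" and W': "(i, d) \<in> W'" by (cases x) auto
    then have d: "d \<in> candidates m - {c}" and i: "i \<in> {1..n}" and above: "(d, c) \<in> voter P i"
      and le: "height m (voter P i) d \<le> height m (voter P i) c + k i"
      using W by (auto simp: W'_def cover_def)
    have "(d, c) \<in> voter ?Q i"
      using mem_apply_lift_swaps_iff[OF P c v L d i] above not_overtaken[OF W'] by simp
    moreover have "height m (voter ?Q i) d \<le> height m (voter ?Q i) c + k i"
    proof (cases "i = v")
      case True
      \<comment> \<open>An opponent still assigned to \<open>v\<close> lies beyond the lift and
        keeps its height while \<open>c\<close> comes closer.\<close>
      then have "?h c + L < ?h d"
        using above not_overtaken[OF W'] d c mem_ranking_iff[OF voter_rankings[OF P v], of d c]
        by (auto simp: overtaken_def)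
      then show ?thesis
        using le True d height_apply_lift_swaps[OF P c v c L]
          height_apply_lift_swaps[OF P c v _ L, of d] by auto
    next
      case False
      then show ?thesis using le voter_apply_lift_swaps_other[OF P i] by simp
    qed
    ultimately show "case x of (i, d) \<Rightarrow> (d, c) \<in> voter ?Q i \<and>
        height m (voter ?Q i) d \<le> height m (voter ?Q i) c + k i"
      by (simp add: x)
  qed
  ultimately show ?thesis using that by blast
qed

section \<open>Harmonic numbers and the potential\<close>

text \<open>The difference consists of \<open>b - a\<close> reciprocals, each at least
  \<open>1 / b\<close>.\<close>

lemma harm_diff_ge:
  assumes "a \<le> b"
  shows "(real b - real a) / real b \<le> harm b - harm a"
  using assms
proof (induction b rule: dec_induct)
  case (step b)
  have "(real b - real a) / (real b + 1) \<le> (real b - real a) / real b"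
    using step by (cases "b = 0") (auto intro!: divide_left_mono)
  moreover have "(real (Suc b) - real a) / real (Suc b) =
      (real b - real a) / (real b + 1) + inverse (real (Suc b))"
    by (simp add: field_simps)
  ultimately show ?case using step.IH unfolding harm_Suc by linarith
qed simp

text \<open>The bound \<open>ln x \<le> x - 1\<close> at \<open>x = n / (n + 1)\<close> shows that
  \<open>ln\<close> grows by at least \<open>1 / (n + 1)\<close> from \<open>n\<close> to
  \<open>n + 1\<close>.\<close>

lemma harm_le_ln:
  assumes "0 < n"
  shows "harm n \<le> ln (real n) + 1"
  using assms
proof (induction n rule: nat_induct_non_zero)
  case (Suc n)
  have "ln (real n) - ln (real (Suc n)) = ln (real n / real (Suc n))"
    using Suc.hyps by (simp add: ln_div)
  also have "\<dots> \<le> real n / real (Suc n) - 1"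
    using Suc.hyps by (intro ln_le_minus_one) simp
  also have "\<dots> = - inverse (real (Suc n))" by (simp add: field_simps)
  finally show ?case using Suc.IH by (simp add: harm_Suc)
qed (simp add: harm_expand)

text \<open>The summand of voter \<open>i\<close> adds up the prices \<open>k i / j\<close> for
  \<open>j\<close> from 1 to the number of its pairs: what is charged if its pairs are dropped one
  at a time, \<open>j\<close> being the number still present.\<close>

definition potential :: "nat \<Rightarrow> (nat \<Rightarrow> nat) \<Rightarrow> (nat \<times> nat) set \<Rightarrow> real" where
  "potential n k W = (\<Sum>i \<in> {1..n}. real (k i) * harm (card (W `` {i})))"

lemma card_eq_sum_Image:
  fixes W :: "(nat \<times> 'a) set"
  assumes "finite W" and "W \<subseteq> {1..n} \<times> UNIV"
  shows "card W = (\<Sum>i \<in> {1..n}. card (W `` {i}))"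
proof -
  have eq: "Sigma {1..n} (\<lambda>i. W `` {i}) = W" using assms(2) by auto
  show ?thesis
    using card_SigmaI[of "{1..n}" "\<lambda>i. W `` {i}"] finite_Image[OF assms(1)] unfolding eq by simp
qed

text \<open>Spread the \<open>L\<close> swaps evenly over the \<open>R\<close> dropped pairs. A
  voter going from \<open>a\<close> to \<open>b\<close> pairs is charged
  \<open>(a - b) * L / R\<close>, by \<open>price\<close> at most \<open>k i * (a - b) / a\<close>,
  which \<open>harm_diff_ge\<close> bounds by the fall of its summand.\<close>

lemma potential_drop:
  fixes L R :: nat
  assumes fin: "finite W" and dom: "W \<subseteq> {1..n} \<times> UNIV" and sub: "W' \<subseteq> W"
    and card: "card W = card W' + R" and R: "0 < R"
    and price: "\<And>i. W `` {i} \<noteq> {} \<Longrightarrow> L * card (W `` {i}) \<le> k i * R"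
  shows "real L + potential n k W' \<le> potential n k W"
proof -
  define a where "a i = card (W `` {i})" for i
  define b where "b i = card (W' `` {i})" for i
  have ba: "b i \<le> a i" for i
    unfolding a_def b_def using sub by (intro card_mono finite_Image[OF fin]) auto
  have "real L / real R * (real (a i) - real (b i)) \<le> real (k i) * (harm (a i) - harm (b i))" for i
  proof (cases "a i = 0")
    case True
    then show ?thesis using ba[of i] by simp
  next
    case False
    then have "W `` {i} \<noteq> {}" by (auto simp: a_def)
    then have "L * a i \<le> k i * R" using price unfolding a_def by blast
    then have "real L * real (a i) \<le> real (k i) * real R"
      by (simp only: of_nat_mult[symmetric] of_nat_le_iff)
    then have "real L / real R \<le> real (k i) / real (a i)" using False R by (simp add: field_simps)
    then have "real L / real R * (real (a i) - real (b i)) \<le>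
        real (k i) / real (a i) * (real (a i) - real (b i))"
      using ba[of i] by (intro mult_right_mono) auto
    also have "\<dots> = real (k i) * ((real (a i) - real (b i)) / real (a i))" by simp
    also have "\<dots> \<le> real (k i) * (harm (a i) - harm (b i))"
      using harm_diff_ge[OF ba[of i]] by (intro mult_left_mono) auto
    finally show ?thesis .
  qed
  then have "(\<Sum>i \<in> {1..n}. real L / real R * (real (a i) - real (b i))) \<le>
      (\<Sum>i \<in> {1..n}. real (k i) * (harm (a i) - harm (b i)))"
    by (intro sum_mono)
  also have "\<dots> = potential n k W - potential n k W'"
    by (simp add: potential_def a_def b_def right_diff_distrib sum_subtractf)
  finally have "real L / real R * ((\<Sum>i \<in> {1..n}. real (a i)) - (\<Sum>i \<in> {1..n}. real (b i))) \<le>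
      potential n k W - potential n k W'"
    by (simp only: sum_distrib_left[symmetric] sum_subtractf)
  moreover have "(\<Sum>i \<in> {1..n}. real (a i)) = real (card W)"
    using card_eq_sum_Image[OF fin dom] by (simp add: a_def)
  moreover have "(\<Sum>i \<in> {1..n}. real (b i)) = real (card W')"
    using card_eq_sum_Image[of W' n] sub dom finite_subset[OF sub fin] by (auto simp: b_def)
  ultimately show ?thesis using card R by simp
qed

lemma greedy_choice_potential:
  assumes P: "P \<in> profiles m n" and c: "c \<in> candidates m" and choice: "greedy_choice m c P es"
    and W: "cover m n c k P W"
  obtains W' where "cover m n c k (apply_swaps m es P) W'"
    and "real (length es) + potential n k W' \<le> potential n k W"
proof -
  from greedy_choiceE[OF P c choice] obtain v L where v: "v \<in> {1..n}"
    and L: "height m (voter P v) c + L < m"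
    and es: "es = lift_swaps v (height m (voter P v) c) L" and ne: "reduced m P c v L \<noteq> {}"
    and min: "\<And>i l. i \<in> {1..n} \<Longrightarrow> height m (voter P i) c + l < m \<Longrightarrow>
      L * card (reduced m P c i l) \<le> l * card (reduced m P c v L)"
    by blast
  obtain W' where W': "W' \<subseteq> W" "card W = card W' + card (reduced m P c v L)"
    and cov: "cover m n c k (apply_swaps m es P) W'"
    using cover_apply_lift_swaps[OF P c v L W] es by metis
  have "L * card (W `` {i}) \<le> k i * card (reduced m P c v L)" if "W `` {i} \<noteq> {}" for i
  proof -
    have i: "i \<in> {1..n}" using that W by (auto simp: cover_def)
    note r = voter_rankings[OF P i]
    \<comment> \<open>The lift is capped at the top of the ranking; every opponent assigned to
      \<open>i\<close> is still overtaken.\<close>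
    define l where "l = min (k i) (m - 1 - height m (voter P i) c)"
    have l: "height m (voter P i) c + l < m" using height_less[OF r c] by (auto simp: l_def)
    have "d \<in> reduced m P c i l" if "(i, d) \<in> W" for d
    proof -
      have d: "d \<in> candidates m" and "(d, c) \<in> voter P i"
        and "height m (voter P i) d \<le> height m (voter P i) c + k i"
        using W that by (auto simp: cover_def)
      then show ?thesis
        using demand_pos_if_cover[OF W that] height_less[OF r d] mem_ranking_iff[OF r d c]
        by (auto simp: reduced_def overtaken_def l_def)
    qed
    then have "card (W `` {i}) \<le> card (reduced m P c i l)" by (intro card_mono) auto
    then have "L * card (W `` {i}) \<le> L * card (reduced m P c i l)" by simp
    also have "\<dots> \<le> l * card (reduced m P c v L)" using min[OF i l] .
    also have "\<dots> \<le> k i * card (reduced m P c v L)" by (simp add: l_def)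
    finally show ?thesis .
  qed
  moreover have "W \<subseteq> {1..n} \<times> UNIV" using W by (auto simp: cover_def)
  ultimately have "real L + potential n k W' \<le> potential n k W"
    using potential_drop[OF finite_cover[OF W] _ W'] ne by (simp add: card_gt_0_iff)
  then show ?thesis using that cov es by simp
qed

section \<open>Length and termination of greedy runs\<close>

text \<open>The falls of the potential telescope, and the potential is never negative. The prices
  \<open>k\<close> stay fixed along the run while the cover shrinks.\<close>

lemma greedy_run_length_le:
  assumes "greedy_run m c P S" and "P \<in> profiles m n" and "c \<in> candidates m"
    and "cover m n c k P W"
  shows "real (length S) \<le> potential n k W"
  using assms
proof (induction arbitrary: W rule: greedy_run.induct)
  case (halt P)
  then show ?case by (auto simp: potential_def intro!: sum_nonneg mult_nonneg_nonneg harm_nonneg)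
next
  case (iterate P es S)
  obtain W' where "cover m n c k (apply_swaps m es P) W'"
    and "real (length es) + potential n k W' \<le> potential n k W"
    using greedy_choice_potential[OF iterate.prems(1,2) iterate.hyps(1) iterate.prems(3)] .
  with iterate.IH[OF apply_swaps_profiles[OF iterate.prems(1)] iterate.prems(2)]
  show ?case by force
qed

text \<open>Makes the accumulated sequence a competitor in the definition of the Dodgson score,
  which yields the lower bound on the output.\<close>

lemma greedy_run_deficit:
  "greedy_run m c P S \<Longrightarrow> deficit m (apply_swaps m S P) c = 0"
proof (induction rule: greedy_run.induct)
  case (halt P)
  moreover have "0 \<le> deficit m P c"
    unfolding deficit_def by (intro sum_nonneg) (auto simp: deficit_against_def)
  ultimately show ?case by simp
qed (simp add: apply_swaps_append)

text \<open>The termination measure: every greedy choice reduces some opponent and raises no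
  demand.\<close>

definition total_demand :: "nat \<Rightarrow> profile \<Rightarrow> nat \<Rightarrow> nat" where
  "total_demand m P c = (\<Sum>d \<in> candidates m - {c}. demand P c d)"

lemma greedy_choice_total_demand:
  assumes P: "P \<in> profiles m n" and c: "c \<in> candidates m" and choice: "greedy_choice m c P es"
  shows "total_demand m (apply_swaps m es P) c < total_demand m P c"
proof -
  from greedy_choiceE[OF P c choice] obtain v L where v: "v \<in> {1..n}"
    and L: "height m (voter P v) c + L < m"
    and es: "es = lift_swaps v (height m (voter P v) c) L" and ne: "reduced m P c v L \<noteq> {}"
    by blast
  note eq = demand_apply_lift_swaps[OF P c v L, folded es]
  obtain d where "d \<in> reduced m P c v L" using ne by auto
  moreover from this have "d \<in> candidates m - {c}" using reduced_subset by blast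
  ultimately show ?thesis
    unfolding total_demand_def using eq
    by (intro sum_strict_mono_ex1) (auto intro!: bexI[of _ d])
qed

lemma greedy_choice_exists:
  assumes P: "P \<in> profiles m n" and c: "c \<in> candidates m" and "0 < deficit m P c"
  shows "\<exists>es. greedy_choice m c P es"
proof -
  have "[] \<in> single_voter_normal m c P" by (simp add: single_voter_normal_def c_normal_def)
  then show ?thesis
    using ex_is_arg_min_if_finite[OF finite_single_voter_normal[OF P c]] assms(3)
    unfolding greedy_choice_def by blast
qed

lemma greedy_run_exists:
  assumes "P \<in> profiles m n" and "c \<in> candidates m"
  shows "\<exists>S. greedy_run m c P S"
  using assms
proof (induction "total_demand m P c" arbitrary: P rule: less_induct)
  case less
  show ?case
  proof (cases "0 < deficit m P c")
    case True
    then obtain es where es: "greedy_choice m c P es"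
      using greedy_choice_exists less.prems by blast
    then show ?thesis
      using less.hyps[OF greedy_choice_total_demand[OF less.prems es] apply_swaps_profiles] less.prems
      by (blast intro: greedy_run.iterate)
  qed (blast intro: greedy_run.halt)
qed

lemma not_greedy_diverges:
  assumes P: "P \<in> profiles m n" and c: "c \<in> candidates m"
  shows "\<not> greedy_diverges m c P"
proof
  assume "greedy_diverges m c P"
  then obtain Q es where "Q 0 = P" and step: "\<And>k :: nat. greedy_choice m c (Q k) (es k)"
    "\<And>k. Q (Suc k) = apply_swaps m (es k) (Q k)"
    by (auto simp: greedy_diverges_def)
  have Q: "Q k \<in> profiles m n" for k
    by (induction k) (use P \<open>Q 0 = P\<close> in \<open>auto simp: step intro: apply_swaps_profiles\<close>)
  have "total_demand m (Q (Suc k)) c < total_demand m (Q k) c" for k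
    unfolding step(2) by (rule greedy_choice_total_demand[OF Q c step(1)])
  \<comment> \<open>After \<open>k\<close> steps the measure has lost at least \<open>k\<close>,
    which is absurd once \<open>k\<close> exceeds its initial value.\<close>
  then have "total_demand m (Q k) c + k \<le> total_demand m (Q 0) c" for k
    by (induction k) (simp, metis add_Suc_right add_Suc add_le_mono1 le_trans Suc_leI)
  from this[of "Suc (total_demand m (Q 0) c)"] show False by simp
qed

section \<open>A cover obtained from an arbitrary solving sequence\<close>

text \<open>A swap reverses at most one pair, in one ranking, so it removes at most one further pair
  of the original profile. This bounds the total price of the cover by the number of swaps.\<close>

lemma sum_card_removed_le:
  assumes P: "P \<in> profiles m n"
  shows "(\<Sum>i \<in> {1..n}. card (voter P i - voter (apply_swaps m es P) i)) \<le> length es"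
proof (induction es rule: rev_induct)
  case (snoc s es)
  obtain v j where s: "s = (v, j)" by (cases s)
  let ?Q = "apply_swaps m es P"
  have Q: "?Q \<in> profiles m n" using P by (rule apply_swaps_profiles)
  have "card (voter P i - voter (apply_swap m s ?Q) i) \<le>
      card (voter P i - voter ?Q i) + (if i = v then 1 else 0)" if i: "i \<in> {1..n}" for i
  proof (cases "i = v \<and> 0 < j \<and> j < m")
    case True
    have fin: "finite (voter P i)"
      using voter_rankings[OF P i] unfolding rankings_def
      by (auto intro: finite_subset[of _ "candidates m \<times> candidates m"])
    define p where "p = (candidate_at m (voter ?Q i) j, candidate_at m (voter ?Q i) (j - 1))"
    have "voter P i - voter (apply_swap m s ?Q) i \<subseteq> insert p (voter P i - voter ?Q i)"
      using True voter_apply_swap[OF Q i] by (auto simp: s exchange_at_def Let_def p_def)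
    then have "card (voter P i - voter (apply_swap m s ?Q) i) \<le>
        card (insert p (voter P i - voter ?Q i))"
      using fin by (intro card_mono) auto
    also have "\<dots> \<le> Suc (card (voter P i - voter ?Q i))"
      using fin by (intro card_insert_le_m1) auto
    finally show ?thesis using True by simp
  next
    case False
    then have "voter (apply_swap m s ?Q) i = voter ?Q i"
      using voter_apply_swap[OF Q i] by (auto simp: s)
    then show ?thesis by simp
  qed
  then have "(\<Sum>i \<in> {1..n}. card (voter P i - voter (apply_swap m s ?Q) i)) \<le>
      (\<Sum>i \<in> {1..n}. card (voter P i - voter ?Q i) + (if i = v then 1 else 0))"
    by (rule sum_mono)
  also have "\<dots> \<le> length es + 1" using snoc by (simp add: sum.distrib)
  finally show ?case by (simp add: apply_swaps_snoc)
qed simp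

text \<open>If \<open>c\<close> is to rise above \<open>d\<close>, every \<open>x\<close> between them must change places with \<open>c\<close> or with \<open>d\<close>.\<close>

lemma height_diff_le_card_removed:
  assumes r: "r \<in> rankings m" and s: "s \<in> rankings m"
    and c: "c \<in> candidates m" and d: "d \<in> candidates m" and "(d, c) \<in> r" and cd: "(c, d) \<in> s"
  shows "height m r d \<le> height m r c + card (r - s)"
proof -
  define X where "X = {x \<in> candidates m. height m r c < height m r x \<and> height m r x \<le> height m r d}"
  \<comment> \<open>If \<open>s\<close> does not rank \<open>c\<close> above \<open>x\<close>, then,
    ranking \<open>c\<close> above \<open>d\<close>, it does not rank \<open>d\<close> above
    \<open>x\<close> either, so \<open>(d, x)\<close> is lost. The first case includes
    \<open>x = d\<close>.\<close>
  define g where "g x = (if (c, x) \<in> s then (x, c) else (d, x))" for x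
  have X: "x \<in> candidates m" "height m r c < height m r x" "height m r x \<le> height m r d"
    if "x \<in> X" for x using that by (auto simp: X_def)
  have "height m r ` X = {height m r c<..height m r d}"
  proof
    show "{height m r c<..height m r d} \<subseteq> height m r ` X"
    proof
      fix y assume y: "y \<in> {height m r c<..height m r d}"
      then have "y < m" using height_less[OF r d] by auto
      from candidate_at[OF r this] y show "y \<in> height m r ` X"
        by (auto simp: X_def image_iff intro!: bexI[of _ "candidate_at m r y"])
    qed
  qed (auto simp: X_def)
  moreover have "inj_on (height m r) X" using height_eq_iff[OF r] X(1) by (auto intro!: inj_onI)
  ultimately have "height m r d - height m r c = card X"
    by (metis card_greaterThanAtMost card_image)
  also have "\<dots> \<le> card (r - s)"
  proof (rule card_inj_on_le)
    show "inj_on g X"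
      using X(2) by (intro inj_onI) (auto simp: g_def split: if_splits)
    show "g ` X \<subseteq> r - s"
    proof
      fix p assume "p \<in> g ` X"
      then obtain x where x: "x \<in> X" and p: "p = g x" by auto
      note hs = mem_ranking_iff[OF s] and hr = mem_ranking_iff[OF r]
      have "x = d \<Longrightarrow> (c, x) \<in> s" using cd by simp
      moreover have "x \<noteq> d \<Longrightarrow> height m r x < height m r d"
        using X[OF x] height_eq_iff[OF r X(1)[OF x] d] by simp
      ultimately show "p \<in> r - s"
        using X[OF x] c d cd unfolding p g_def by (auto simp: hs hr)
    qed
    show "finite (r - s)"
      using r by (auto simp: rankings_def intro: finite_subset[of _ "candidates m \<times> candidates m"])
  qed
  finally show ?thesis by simp
qed

text \<open>The set \<open>V d\<close> holds the voters who change sides in favour of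
  \<open>c\<close>. They outnumber or equal the demand, because in \<open>Q\<close> no demand is
  left; exactly as many as demanded are selected. The prices suffice by
  \<open>height_diff_le_card_removed\<close>.\<close>

lemma cover_exists:
  assumes P: "P \<in> profiles m n" and c: "c \<in> candidates m" and Q: "Q \<in> profiles m n"
    and zero: "deficit m Q c = 0"
  shows "\<exists>W. cover m n c (\<lambda>i. card (voter P i - voter Q i)) P W"
proof -
  define V where "V d = {i \<in> {1..n}. (d, c) \<in> voter P i \<and> (c, d) \<in> voter Q i}" for d
  have "\<exists>T \<subseteq> V d. card T = demand P c d" if d: "d \<in> candidates m - {c}" for d
  proof -
    let ?A = "{i \<in> {1..n}. (d, c) \<in> voter P i}" and ?B = "{i \<in> {1..n}. (d, c) \<in> voter Q i}"
    have "(d, c) \<in> voter Q i \<or> (c, d) \<in> voter Q i" if "i \<in> {1..n}" for i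
      using mem_ranking_iff[OF voter_rankings[OF Q that]] c d
        height_eq_iff[OF voter_rankings[OF Q that], of c d] by auto
    then have "?A \<subseteq> V d \<union> ?B" by (auto simp: V_def)
    then have "card ?A \<le> card (V d \<union> ?B)" by (intro card_mono) (auto simp: V_def)
    also have "\<dots> \<le> card (V d) + card ?B" by (rule card_Un_le)
    finally have "votes_against P c d \<le> card (V d) + votes_against Q c d"
      by (simp add: votes_against_def length_profiles[OF P] length_profiles[OF Q])
    moreover have "demand Q c d = 0" using deficit_pos_iff[OF Q c] zero d by auto
    ultimately have "demand P c d \<le> card (V d)"
      unfolding demand_def length_profiles[OF P] length_profiles[OF Q] by linarith
    then show ?thesis by (metis obtain_subset_with_card_n)
  qed
  then obtain T where T: "T d \<subseteq> V d" "card (T d) = demand P c d"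
    if "d \<in> candidates m - {c}" for d by metis
  define W where "W = {(i, d). d \<in> candidates m - {c} \<and> i \<in> T d}"
  have "cover m n c (\<lambda>i. card (voter P i - voter Q i)) P W"
    unfolding cover_def
  proof (intro conjI ballI)
    show "W \<subseteq> {1..n} \<times> (candidates m - {c})" using T(1) unfolding W_def V_def by blast
    show "card {i. (i, d) \<in> W} = demand P c d" if "d \<in> candidates m - {c}" for d
      using that T(2) by (simp add: W_def)
    fix x assume "x \<in> W"
    then obtain i d where x: "x = (i, d)" and d: "d \<in> candidates m - {c}" and "i \<in> V d"
      using T(1) by (auto simp: W_def)
    then have "i \<in> {1..n}" "(d, c) \<in> voter P i" "(c, d) \<in> voter Q i" by (auto simp: V_def)
    then show "case x of (i, d) \<Rightarrow> (d, c) \<in> voter P i \<and>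
        height m (voter P i) d \<le> height m (voter P i) c + card (voter P i - voter Q i)"
      using height_diff_le_card_removed[OF voter_rankings[OF P] voter_rankings[OF Q] c] d
      by (simp add: x)
  qed
  then show ?thesis by blast
qed

section \<open>The logarithmic approximation ratio\<close>

text \<open>A voter covers at most \<open>m\<close> opponents, so each price enters the potential
  with a factor of at most \<open>harm m\<close>, and the prices sum up to at most
  \<open>length es\<close>.\<close>

lemma greedy_run_length_le_ln:
  assumes P: "P \<in> profiles m n" and c: "c \<in> candidates m" and run: "greedy_run m c P S"
    and zero: "deficit m (apply_swaps m es P) c = 0"
  shows "real (length S) \<le> (ln (real m) + 1) * real (length es)"
proof -
  let ?Q = "apply_swaps m es P"
  define k where "k = (\<lambda>i. card (voter P i - voter ?Q i))"
  obtain W where W: "cover m n c k P W"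
    using cover_exists[OF P c apply_swaps_profiles[OF P] zero] by (auto simp: k_def)
  have m: "0 < m" using c by (auto simp: candidates_def)
  have harm: "harm (card (W `` {i})) \<le> ln (real m) + 1" for i
  proof -
    have "card (W `` {i}) \<le> card (candidates m)"
      using W by (intro card_mono) (auto simp: cover_def)
    then have "harm (card (W `` {i})) \<le> (harm m :: real)" by (intro harm_mono) simp
    also have "\<dots> \<le> ln (real m) + 1" using harm_le_ln[of m] m by simp
    finally show ?thesis .
  qed
  have "real (length S) \<le> potential n k W" by (rule greedy_run_length_le[OF run P c W])
  also have "\<dots> \<le> (\<Sum>i \<in> {1..n}. real (k i) * (ln (real m) + 1))"
    unfolding potential_def using harm by (intro sum_mono mult_left_mono) auto
  also have "\<dots> = real (\<Sum>i \<in> {1..n}. k i) * (ln (real m) + 1)"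
    by (simp add: sum_distrib_right)
  also have "\<dots> \<le> real (length es) * (ln (real m) + 1)"
    using sum_card_removed_le[OF P, of es] m by (intro mult_right_mono of_nat_mono) (auto simp: k_def)
  finally show ?thesis by (simp add: mult.commute)
qed

theorem theorem3:
  fixes m n c :: nat and P :: profile
  assumes "P \<in> profiles m n" and "c \<in> candidates m"
  shows "\<not> greedy_diverges m c P \<and> (\<exists>A. greedy_output m c P A) \<and>
    (\<forall>A. greedy_output m c P A \<longrightarrow>
       dodgson_score m P c \<le> A \<and>
       real A \<le> (ln (real m) + 1) * real (dodgson_score m P c))"
proof (intro conjI allI impI)
  show "\<not> greedy_diverges m c P" using not_greedy_diverges assms .
  show ex: "\<exists>A. greedy_output m c P A"
    using greedy_run_exists[OF assms] by (auto simp: greedy_output_def)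
  fix A assume "greedy_output m c P A"
  then obtain S where run: "greedy_run m c P S" and A: "A = length S"
    by (auto simp: greedy_output_def)
  let ?solves = "\<lambda>p. \<exists>es :: swap list. length es = p \<and> deficit m (apply_swaps m es P) c = 0"
  have solves: "?solves A" using greedy_run_deficit[OF run] A by blast
  then show "dodgson_score m P c \<le> A" unfolding dodgson_score_def by (rule Least_le)
  \<comment> \<open>The greedy run shows that some length solves, so the least one is
    attained.\<close>
  have "?solves (dodgson_score m P c)"
    unfolding dodgson_score_def using solves by (rule LeastI)
  then obtain es :: "swap list" where "length es = dodgson_score m P c"
    and "deficit m (apply_swaps m es P) c = 0" by blast
  then show "real A \<le> (ln (real m) + 1) * real (dodgson_score m P c)"
    using greedy_run_length_le_ln[OF assms run, of es] A by simp
qed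

end
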